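(* Let $\mathcal A$ be an additive category. Let $\mathrm S_{\mathcal A}$ be the set of all objects of $\mathcal A^{\Delta_2}$ of the form $(X\xrightarrow{1}X\xrightarrow{s}Y)$ or of the form $(X\xrightarrow{s}Y\xrightarrow{1}Y)$, where $s\colon X\to Y$ runs through the morphisms of $\mathcal A$. Let $\langle \mathrm S_{\mathcal A}\rangle$ be the full additive subcategory of $\mathcal A^{\Delta_2}$ generated by $\mathrm S_{\mathcal A}$. Let $\mathrm F_{\langle \mathrm S_{\mathcal A}\rangle}$ be the set of all morphisms of $\mathcal A^{\Delta_2}$ that factor through an object of $\langle \mathrm S_{\mathcal A}\rangle$, and let $\mathrm J_{\mathcal A}$ be the set of all null-homotopic morphisms of $\mathcal A^{\Delta_2}$. Then $$\mathrm F_{\langle \mathrm S_{\mathcal A}\rangle}=\mathrm J_{\mathcal A},$$ and therefore $\operatorname{Adel}(\mathcal A)=\mathcal A^{\Delta_2}/\langle \mathrm S_{\mathcal A}\rangle$.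
   Context: Conventions: morphisms are composed from left to right ($fg$ means first $f$, then $g$). For an additive category $\mathcal A$, $\mathcal A^{\Delta_2}$ is the (additive) category whose objects are diagrams $A=(A_0\xrightarrow{a_0}A_1\xrightarrow{a_1}A_2)$ in $\mathcal A$ (with no condition on $a_0a_1$) and whose morphisms $f\colon A\to B$ are triples $f=(f_0,f_1,f_2)$, $f_i\colon A_i\to B_i$, with $a_0f_1=f_0b_0$ and $a_1f_2=f_1b_1$; direct sums are formed componentwise. A morphism $f\colon A\to B$ is null-homotopic if there are morphisms $s\colon A_1\to B_0$ and $t\colon A_2\to B_1$ in $\mathcal A$ with $sb_0+a_1t=f_1$. The null-homotopic morphisms form an ideal $\mathrm J_{\mathcal A}$, and the Adelman category is the quotient category $\operatorname{Adel}(\mathcal A)=\mathcal A^{\Delta_2}/\mathrm J_{\mathcal A}$ (same objects, morphism groups $\operatorname{Hom}(A,B)/(\operatorname{Hom}(A,B)\cap \mathrm J_{\mathcal A})$). For a set $M$ of objects of an additive category $\mathcal C$, $\langle M\rangle$ is the full subcategory of $\mathcal C$ on all objects isomorphic to $\bigoplus_{i=1}^{\ell}X_i$ for some $\ell\ge 0$ and $X_i\in M$. For a full additive subcategory $\mathcal N\subseteq\mathcal C$, the set $\mathrm F_{\mathcal N}$ of morphisms factoring through an object of $\mathcal N$ is an ideal of $\mathcal C$, and $\mathcal C/\mathcal N:=\mathcal C/\mathrm F_{\mathcal N}$ denotes the quotient category. *)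

theory Defs
  imports "HOL-Algebra.Coset" "HOL-Algebra.FiniteProduct"
begin

section \<open>Additive categories\<close>

text \<open>
  Composition is written from left to right: \<open>f \<odot>\<^bsub>C\<^esub> g\<close> means first \<open>f\<close>, then \<open>g\<close>.
  The operations are total functions, but they are specified only where they make sense
  (\<open>Comp\<close> on composable morphisms, \<open>Add\<close> on parallel morphisms, and so on).
\<close>

record ('o, 'm) precategory =
  Obj :: "'o set"
  Mor :: "'m set"
  Dom :: "'m \<Rightarrow> 'o"
  Cod :: "'m \<Rightarrow> 'o"
  Ident :: "'o \<Rightarrow> 'm"
  Comp :: "'m \<Rightarrow> 'm \<Rightarrow> 'm" (infixl "\<odot>\<index>" 70)
  Add :: "'m \<Rightarrow> 'm \<Rightarrow> 'm" (infixl "\<boxplus>\<index>" 65)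
  Zero :: "'o \<Rightarrow> 'o \<Rightarrow> 'm"

definition Hom :: "('o, 'm) precategory \<Rightarrow> 'o \<Rightarrow> 'o \<Rightarrow> 'm set" where
  "Hom C A B = {f \<in> Mor C. Dom C f = A \<and> Cod C f = B}"

text \<open>The morphism group from \<open>A\<close> to \<open>B\<close>; its group operation is the addition of \<open>C\<close>.\<close>

definition Hom_group :: "('o, 'm) precategory \<Rightarrow> 'o \<Rightarrow> 'o \<Rightarrow> 'm monoid" where
  "Hom_group C A B = \<lparr>carrier = Hom C A B, mult = Add C, one = Zero C A B\<rparr>"

locale category =
  fixes C :: "('o, 'm) precategory" (structure)
  assumes Dom_closed: "f \<in> Mor C \<Longrightarrow> Dom C f \<in> Obj C"
    and Cod_closed: "f \<in> Mor C \<Longrightarrow> Cod C f \<in> Obj C"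
    and Ident_closed: "A \<in> Obj C \<Longrightarrow> Ident C A \<in> Hom C A A"
    and Comp_closed: "f \<in> Hom C A B \<Longrightarrow> g \<in> Hom C B D \<Longrightarrow> f \<odot> g \<in> Hom C A D"
    and Ident_left: "f \<in> Hom C A B \<Longrightarrow> Ident C A \<odot> f = f"
    and Ident_right: "f \<in> Hom C A B \<Longrightarrow> f \<odot> Ident C B = f"
    and Comp_assoc: "f \<in> Hom C A B \<Longrightarrow> g \<in> Hom C B D \<Longrightarrow> h \<in> Hom C D E \<Longrightarrow>
      (f \<odot> g) \<odot> h = f \<odot> (g \<odot> h)"

locale preadditive_category = category +
  assumes Hom_comm_group: "A \<in> Obj C \<Longrightarrow> B \<in> Obj C \<Longrightarrow> comm_group (Hom_group C A B)"
    and Comp_Add_left: "f \<in> Hom C A B \<Longrightarrow> f' \<in> Hom C A B \<Longrightarrow> g \<in> Hom C B D \<Longrightarrow>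
      (f \<boxplus> f') \<odot> g = f \<odot> g \<boxplus> f' \<odot> g"
    and Comp_Add_right: "f \<in> Hom C A B \<Longrightarrow> g \<in> Hom C B D \<Longrightarrow> g' \<in> Hom C B D \<Longrightarrow>
      f \<odot> (g \<boxplus> g') = f \<odot> g \<boxplus> f \<odot> g'"

text \<open>
  \<open>D\<close> is a direct sum of \<open>X 0, \<dots>, X (l - 1)\<close>, by means of inclusions \<open>\<iota> j\<close> and
  projections \<open>\<pi> j\<close>. For \<open>l = 0\<close> the sum is empty, so \<open>D\<close> is a zero object.
\<close>

definition is_direct_sum ::
  "('o, 'm) precategory \<Rightarrow> 'o \<Rightarrow> nat \<Rightarrow> (nat \<Rightarrow> 'o) \<Rightarrow> bool" where
  "is_direct_sum C D l X \<longleftrightarrow> D \<in> Obj C \<and> (\<forall>j<l. X j \<in> Obj C) \<and>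
    (\<exists>\<iota> \<pi>. (\<forall>j<l. \<iota> j \<in> Hom C (X j) D \<and> \<pi> j \<in> Hom C D (X j)) \<and>
      (\<forall>j<l. \<forall>k<l. \<iota> j \<odot>\<^bsub>C\<^esub> \<pi> k = (if j = k then Ident C (X j) else Zero C (X j) (X k))) \<and>
      finprod (Hom_group C D D) (\<lambda>j. \<pi> j \<odot>\<^bsub>C\<^esub> \<iota> j) {..<l} = Ident C D)"

locale additive_category = preadditive_category +
  assumes direct_sum_exists:
    "(\<And>j. j < l \<Longrightarrow> X j \<in> Obj C) \<Longrightarrow> \<exists>D. is_direct_sum C D l X"

definition isomorphic :: "('o, 'm) precategory \<Rightarrow> 'o \<Rightarrow> 'o \<Rightarrow> bool" where
  "isomorphic C A B \<longleftrightarrow> (\<exists>f \<in> Hom C A B. \<exists>g \<in> Hom C B A.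
    f \<odot>\<^bsub>C\<^esub> g = Ident C A \<and> g \<odot>\<^bsub>C\<^esub> f = Ident C B)"


section \<open>Full subcategories and quotient categories\<close>

definition full_subcategory ::
  "('o, 'm) precategory \<Rightarrow> 'o set \<Rightarrow> ('o, 'm) precategory" where
  "full_subcategory C N =
    C\<lparr>Obj := N, Mor := {f \<in> Mor C. Dom C f \<in> N \<and> Cod C f \<in> N}\<rparr>"

definition generated_subcategory ::
  "('o, 'm) precategory \<Rightarrow> 'o set \<Rightarrow> ('o, 'm) precategory" where
  "generated_subcategory C M = full_subcategory C
    {Y \<in> Obj C. \<exists>l X D. (\<forall>j<l. X j \<in> M) \<and> is_direct_sum C D l X \<and> isomorphic C Y D}"

definition factoring_morphisms ::
  "('o, 'm) precategory \<Rightarrow> ('o, 'm) precategory \<Rightarrow> 'm set" where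
  "factoring_morphisms C N = {f \<in> Mor C.
    \<exists>K \<in> Obj N. \<exists>g \<in> Hom C (Dom C f) K. \<exists>h \<in> Hom C K (Cod C f). f = g \<odot>\<^bsub>C\<^esub> h}"

definition residue_class ::
  "('o, 'm) precategory \<Rightarrow> 'm set \<Rightarrow> 'm \<Rightarrow> 'm set" where
  "residue_class C J f =
    (Hom C (Dom C f) (Cod C f) \<inter> J) #>\<^bsub>Hom_group C (Dom C f) (Cod C f)\<^esub> f"

text \<open>
  The quotient by an ideal \<open>J\<close>: the morphisms from \<open>A\<close> to \<open>B\<close> are the elements of the factor
  group of the morphism group of \<open>C\<close> by \<open>Hom C A B \<inter> J\<close>. Since the sets \<open>Hom C A B\<close> are pairwise
  disjoint, so are these factor groups. Domain and codomain of a class are those of any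
  representative; in the composite of two classes, the union is over identical sets because
  \<open>J\<close> is an ideal.
\<close>

definition quotient_category ::
  "('o, 'm) precategory \<Rightarrow> 'm set \<Rightarrow> ('o, 'm set) precategory" where
  "quotient_category C J = \<lparr>
    Obj = Obj C,
    Mor = (\<Union>A \<in> Obj C. \<Union>B \<in> Obj C. carrier (Hom_group C A B Mod (Hom C A B \<inter> J))),
    Dom = (\<lambda>F. Dom C (SOME f. f \<in> F)),
    Cod = (\<lambda>F. Cod C (SOME f. f \<in> F)),
    Ident = (\<lambda>A. residue_class C J (Ident C A)),
    Comp = (\<lambda>F G. \<Union>f \<in> F. \<Union>g \<in> G. residue_class C J (f \<odot>\<^bsub>C\<^esub> g)),
    Add = (\<lambda>F G. {f \<boxplus>\<^bsub>C\<^esub> g | f g. f \<in> F \<and> g \<in> G}),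
    Zero = (\<lambda>A B. Hom C A B \<inter> J)\<rparr>"

definition quotient_by_subcategory ::
  "('o, 'm) precategory \<Rightarrow> ('o, 'm) precategory \<Rightarrow> ('o, 'm set) precategory" where
  "quotient_by_subcategory C N = quotient_category C (factoring_morphisms C N)"


section \<open>Diagrams and the Adelman category\<close>

text \<open>\<open>Diag A\<^sub>0 a\<^sub>0 A\<^sub>1 a\<^sub>1 A\<^sub>2\<close> stands for the diagram with \<open>a\<^sub>0\<close> from \<open>A\<^sub>0\<close> to \<open>A\<^sub>1\<close> and \<open>a\<^sub>1\<close> from
  \<open>A\<^sub>1\<close> to \<open>A\<^sub>2\<close>.\<close>

datatype ('o, 'm) diagram =
  Diag (ob0: 'o) (map0: 'm) (ob1: 'o) (map1: 'm) (ob2: 'o)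

text \<open>The triple of components does not determine source and target, so these are recorded.\<close>

datatype ('o, 'm) diagram_mor =
  DMor (source: "('o, 'm) diagram") (comp0: 'm) (comp1: 'm) (comp2: 'm)
    (target: "('o, 'm) diagram")

definition diagram_category ::
  "('o, 'm) precategory \<Rightarrow> (('o, 'm) diagram, ('o, 'm) diagram_mor) precategory" where
  "diagram_category \<A> =
    (let Ob = {A. ob0 A \<in> Obj \<A> \<and> ob1 A \<in> Obj \<A> \<and> ob2 A \<in> Obj \<A> \<and>
                map0 A \<in> Hom \<A> (ob0 A) (ob1 A) \<and> map1 A \<in> Hom \<A> (ob1 A) (ob2 A)}
     in \<lparr>
      Obj = Ob,
      Mor = {DMor A f\<^sub>0 f\<^sub>1 f\<^sub>2 B | A f\<^sub>0 f\<^sub>1 f\<^sub>2 B. A \<in> Ob \<and> B \<in> Ob \<and>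
        f\<^sub>0 \<in> Hom \<A> (ob0 A) (ob0 B) \<and> f\<^sub>1 \<in> Hom \<A> (ob1 A) (ob1 B) \<and> f\<^sub>2 \<in> Hom \<A> (ob2 A) (ob2 B) \<and>
        map0 A \<odot>\<^bsub>\<A>\<^esub> f\<^sub>1 = f\<^sub>0 \<odot>\<^bsub>\<A>\<^esub> map0 B \<and> map1 A \<odot>\<^bsub>\<A>\<^esub> f\<^sub>2 = f\<^sub>1 \<odot>\<^bsub>\<A>\<^esub> map1 B},
      Dom = source,
      Cod = target,
      Ident = (\<lambda>A. DMor A (Ident \<A> (ob0 A)) (Ident \<A> (ob1 A)) (Ident \<A> (ob2 A)) A),
      Comp = (\<lambda>f g. DMor (source f) (comp0 f \<odot>\<^bsub>\<A>\<^esub> comp0 g) (comp1 f \<odot>\<^bsub>\<A>\<^esub> comp1 g)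
        (comp2 f \<odot>\<^bsub>\<A>\<^esub> comp2 g) (target g)),
      Add = (\<lambda>f g. DMor (source f) (comp0 f \<boxplus>\<^bsub>\<A>\<^esub> comp0 g) (comp1 f \<boxplus>\<^bsub>\<A>\<^esub> comp1 g)
        (comp2 f \<boxplus>\<^bsub>\<A>\<^esub> comp2 g) (target f)),
      Zero = (\<lambda>A B. DMor A (Zero \<A> (ob0 A) (ob0 B)) (Zero \<A> (ob1 A) (ob1 B))
        (Zero \<A> (ob2 A) (ob2 B)) B)\<rparr>)"

definition null_homotopic ::
  "('o, 'm) precategory \<Rightarrow> ('o, 'm) diagram_mor set" where
  "null_homotopic \<A> = {f \<in> Mor (diagram_category \<A>).
    \<exists>s \<in> Hom \<A> (ob1 (source f)) (ob0 (target f)).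
    \<exists>t \<in> Hom \<A> (ob2 (source f)) (ob1 (target f)).
      s \<odot>\<^bsub>\<A>\<^esub> map0 (target f) \<boxplus>\<^bsub>\<A>\<^esub> map1 (source f) \<odot>\<^bsub>\<A>\<^esub> t = comp1 f}"

definition Adel ::
  "('o, 'm) precategory \<Rightarrow> (('o, 'm) diagram, ('o, 'm) diagram_mor set) precategory" where
  "Adel \<A> = quotient_category (diagram_category \<A>) (null_homotopic \<A>)"

definition S_objects :: "('o, 'm) precategory \<Rightarrow> ('o, 'm) diagram set" where
  "S_objects \<A> = {Diag X (Ident \<A> X) X s Y | X Y s. s \<in> Hom \<A> X Y} \<union>
    {Diag X s Y (Ident \<A> Y) Y | X Y s. s \<in> Hom \<A> X Y}"

end

theory Submission
  imports Defs
begin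

text \<open>
  The identity of \<open>X \<rightarrow> X \<rightarrow> Y\<close> (first arrow \<open>1\<close>) and that of \<open>X \<rightarrow> Y \<rightarrow> Y\<close> (second arrow \<open>1\<close>)
  are null-homotopic. As the null-homotopic morphisms form an ideal, everything factoring
  through a direct sum of such objects is null-homotopic.

  Conversely, let \<open>f: A \<rightarrow> B\<close> with \<open>f\<^sub>1 = s b\<^sub>0 + a\<^sub>1 t\<close>. Then
  \<open>f = (a\<^sub>0 s, s b\<^sub>0, f\<^sub>2 - t b\<^sub>1) + (f\<^sub>0 - a\<^sub>0 s, a\<^sub>1 t, t b\<^sub>1)\<close>, where the first summand is the composite of
  \<open>(a\<^sub>0, 1, 1)\<close> and \<open>(s, s b\<^sub>0, f\<^sub>2 - t b\<^sub>1)\<close> through \<open>A\<^sub>1 \<rightarrow> A\<^sub>1 \<rightarrow> A\<^sub>2\<close> with arrows \<open>1, a\<^sub>1\<close>, and the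
  second is the composite of \<open>(f\<^sub>0 - a\<^sub>0 s, a\<^sub>1 t, t)\<close> and \<open>(1, 1, b\<^sub>1)\<close> through \<open>B\<^sub>0 \<rightarrow> B\<^sub>1 \<rightarrow> B\<^sub>1\<close> with
  arrows \<open>b\<^sub>0, 1\<close>.
\<close>

section \<open>Commutative squares in a category\<close>

context category
begin

lemma Hom_objects:
  assumes "f \<in> Hom C A B"
  shows "A \<in> Obj C" "B \<in> Obj C"
  using assms Dom_closed Cod_closed by (auto simp: Hom_def)

text \<open>Two commutative squares placed next to each other paste to one. This serves both squares
  of a composite of diagram morphisms.\<close>

lemma Comp_squares:
  assumes "a \<in> Hom C X Y" "b \<in> Hom C X' Y'" "c \<in> Hom C X'' Y''"
    and "f \<in> Hom C X X'" "f' \<in> Hom C X' X''" "g \<in> Hom C Y Y'" "g' \<in> Hom C Y' Y''"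
    and "a \<odot> g = f \<odot> b" "b \<odot> g' = f' \<odot> c"
  shows "a \<odot> (g \<odot> g') = f \<odot> f' \<odot> c"
  using Comp_assoc[OF assms(1,6,7)] Comp_assoc[OF assms(4,2,7)] Comp_assoc[OF assms(4,5,3)]
    assms(8,9)
  by simp

lemma isomorphic_refl: "A \<in> Obj C \<Longrightarrow> isomorphic C A A"
  unfolding isomorphic_def using Ident_closed Ident_left by blast

end

section \<open>Arithmetic in the morphism groups\<close>

context preadditive_category
begin

lemma Hom_comm_monoid: "A \<in> Obj C \<Longrightarrow> B \<in> Obj C \<Longrightarrow> comm_monoid (Hom_group C A B)"
  using Hom_comm_group comm_group.axioms(1) by blast

lemma Add_closed: "f \<in> Hom C A B \<Longrightarrow> g \<in> Hom C A B \<Longrightarrow> f \<boxplus> g \<in> Hom C A B"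
  using comm_monoid.axioms(1)[OF Hom_comm_monoid[OF Hom_objects], of f A B]
    monoid.m_closed[of "Hom_group C A B" f g]
  by (simp add: Hom_group_def)

lemma Zero_closed: "A \<in> Obj C \<Longrightarrow> B \<in> Obj C \<Longrightarrow> Zero C A B \<in> Hom C A B"
  using comm_monoid.axioms(1)[OF Hom_comm_monoid] monoid.one_closed[of "Hom_group C A B"]
  by (simp add: Hom_group_def)

lemma Add_assoc:
  "f \<in> Hom C A B \<Longrightarrow> g \<in> Hom C A B \<Longrightarrow> h \<in> Hom C A B \<Longrightarrow> f \<boxplus> g \<boxplus> h = f \<boxplus> (g \<boxplus> h)"
  using comm_monoid.axioms(1)[OF Hom_comm_monoid[OF Hom_objects], of f A B]
    monoid.m_assoc[of "Hom_group C A B" f g h]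
  by (simp add: Hom_group_def)

lemma Add_commute: "f \<in> Hom C A B \<Longrightarrow> g \<in> Hom C A B \<Longrightarrow> f \<boxplus> g = g \<boxplus> f"
  using comm_monoid.m_comm[OF Hom_comm_monoid[OF Hom_objects], of f A B]
  by (simp add: Hom_group_def)

lemma Zero_Add: "f \<in> Hom C A B \<Longrightarrow> Zero C A B \<boxplus> f = f"
  using comm_monoid.axioms(1)[OF Hom_comm_monoid[OF Hom_objects], of f A B]
    monoid.l_one[of "Hom_group C A B" f]
  by (simp add: Hom_group_def)

lemma Add_Zero: "f \<in> Hom C A B \<Longrightarrow> f \<boxplus> Zero C A B = f"
  using Zero_Add Add_commute Zero_closed Hom_objects by metis

text \<open>Regroups the middle components when two null-homotopies are added: the sums of their
  \<open>s\<close>-parts and of their \<open>t\<close>-parts must be collected separately.\<close>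

lemma Add_interchange:
  assumes "f \<in> Hom C A B" "g \<in> Hom C A B" "h \<in> Hom C A B" "k \<in> Hom C A B"
  shows "(f \<boxplus> g) \<boxplus> (h \<boxplus> k) = (f \<boxplus> h) \<boxplus> (g \<boxplus> k)"
proof -
  have "(f \<boxplus> g) \<boxplus> (h \<boxplus> k) = f \<boxplus> ((g \<boxplus> h) \<boxplus> k)"
    using assms by (simp add: Add_assoc[where A=A and B=B] Add_closed)
  also have "\<dots> = f \<boxplus> ((h \<boxplus> g) \<boxplus> k)"
    using Add_commute[OF assms(2,3)] by simp
  also have "\<dots> = (f \<boxplus> h) \<boxplus> (g \<boxplus> k)"
    using assms by (simp add: Add_assoc[where A=A and B=B] Add_closed)
  finally show ?thesis .
qed

text \<open>The record of operations contains no subtraction, so a difference is obtained from the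
  group inverse and afterwards known only through \<open>d \<boxplus> g = f\<close>. It provides
  negatives of diagram morphisms as well as the differences in the decomposition of a null-homotopic
  morphism.\<close>

lemma difference_exists:
  assumes "f \<in> Hom C A B" "g \<in> Hom C A B"
  obtains d where "d \<in> Hom C A B" "d \<boxplus> g = f"
proof -
  interpret G: comm_group "Hom_group C A B"
    using Hom_comm_group Hom_objects assms by blast
  let ?i = "inv\<^bsub>Hom_group C A B\<^esub> g"
  have "f \<in> carrier (Hom_group C A B)" "g \<in> carrier (Hom_group C A B)"
    using assms by (auto simp: Hom_group_def)
  then have "f \<otimes>\<^bsub>Hom_group C A B\<^esub> ?i \<in> carrier (Hom_group C A B)"
    "f \<otimes>\<^bsub>Hom_group C A B\<^esub> ?i \<otimes>\<^bsub>Hom_group C A B\<^esub> g = f"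
    by (simp_all add: G.m_assoc)
  then show ?thesis
    using that by (simp add: Hom_group_def)
qed

lemma Add_right_cancel:
  assumes "f \<in> Hom C A B" "g \<in> Hom C A B" "h \<in> Hom C A B"
  shows "f \<boxplus> h = g \<boxplus> h \<longleftrightarrow> f = g"
proof -
  interpret G: comm_group "Hom_group C A B"
    using Hom_comm_group Hom_objects assms by blast
  show ?thesis
    using G.right_cancel[of h f g] assms by (simp add: Hom_group_def)
qed

text \<open>With \<open>z\<close> the zero morphism, \<open>z \<boxplus> z = z\<close> and
  bilinearity make \<open>z \<odot> f\<close> equal to its own double; cancelling one copy leaves
  zero.\<close>

lemma Zero_Comp:
  assumes "A \<in> Obj C" "f \<in> Hom C B D"
  shows "Zero C A B \<odot> f = Zero C A D"
proof -
  let ?z = "Zero C A B"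
  have z: "?z \<in> Hom C A B" using assms Zero_closed Hom_objects by blast
  have zf: "?z \<odot> f \<in> Hom C A D" using z assms Comp_closed by blast
  have "?z \<odot> f \<boxplus> ?z \<odot> f = Zero C A D \<boxplus> ?z \<odot> f"
    using Comp_Add_left[OF z z assms(2)] Zero_Add[OF z] Zero_Add[OF zf] by simp
  then show ?thesis
    using Add_right_cancel[OF zf Zero_closed zf] Hom_objects[OF zf] by blast
qed

lemma Comp_Zero:
  assumes "f \<in> Hom C A B" "D \<in> Obj C"
  shows "f \<odot> Zero C B D = Zero C A D"
proof -
  let ?z = "Zero C B D"
  have z: "?z \<in> Hom C B D" using assms Zero_closed Hom_objects by blast
  have fz: "f \<odot> ?z \<in> Hom C A D" using z assms Comp_closed by blast
  have "f \<odot> ?z \<boxplus> f \<odot> ?z = Zero C A D \<boxplus> f \<odot> ?z"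
    using Comp_Add_right[OF assms(1) z z] Zero_Add[OF z] Zero_Add[OF fz] by simp
  then show ?thesis
    using Add_right_cancel[OF fz Zero_closed fz] Hom_objects[OF fz] by blast
qed

text \<open>Bilinearity applied to both sides of a square; this makes the componentwise sum of two
  diagram morphisms a diagram morphism.\<close>

lemma Add_squares:
  assumes "a \<in> Hom C X Y" "b \<in> Hom C X' Y'"
    and "f \<in> Hom C X X'" "f' \<in> Hom C X X'" "g \<in> Hom C Y Y'" "g' \<in> Hom C Y Y'"
    and "a \<odot> g = f \<odot> b" "a \<odot> g' = f' \<odot> b"
  shows "a \<odot> (g \<boxplus> g') = (f \<boxplus> f') \<odot> b"
  using Comp_Add_right[OF assms(1,5,6)] Comp_Add_left[OF assms(3,4,2)] assms(7,8) by simp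

section \<open>Finite sums of morphisms and factorization through a generated subcategory\<close>

lemma finprod_Hom_two:
  assumes "p 0 \<in> Hom C A B" "p 1 \<in> Hom C A B"
  shows "finprod (Hom_group C A B) p {..<2::nat} = p 0 \<boxplus> p 1"
proof -
  interpret G: comm_monoid "Hom_group C A B"
    using Hom_comm_monoid Hom_objects assms by blast
  have p: "p 0 \<in> carrier (Hom_group C A B)" "p 1 \<in> carrier (Hom_group C A B)"
    using assms by (simp_all add: Hom_group_def)
  have "finprod (Hom_group C A B) p (insert 0 {1}) =
      p 0 \<otimes>\<^bsub>Hom_group C A B\<^esub> finprod (Hom_group C A B) p (insert 1 {})"
    by (rule G.finprod_insert) (use p in auto)
  also have "finprod (Hom_group C A B) p (insert 1 {}) =
      p 1 \<otimes>\<^bsub>Hom_group C A B\<^esub> finprod (Hom_group C A B) p {}"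
    by (rule G.finprod_insert) (use p in auto)
  also have "\<dots> = p 1"
    unfolding G.finprod_empty using p by simp
  also have "insert 0 {1} = {..<2::nat}"
    by auto
  finally show ?thesis
    by (simp add: Hom_group_def)
qed

text \<open>\<open>Hom_group\<close> is written multiplicatively, so \<open>finprod\<close> is a
  finite sum of morphisms. Closure of \<open>J\<close> under zero and binary sums then extends to
  finite sums by induction on the index set.\<close>

lemma finprod_Hom_in:
  assumes "A \<in> Obj C" "B \<in> Obj C" "Zero C A B \<in> J"
    and add: "\<And>f g. f \<in> Hom C A B \<inter> J \<Longrightarrow> g \<in> Hom C A B \<inter> J \<Longrightarrow> f \<boxplus> g \<in> J"
    and "finite I" "\<And>i. i \<in> I \<Longrightarrow> p i \<in> Hom C A B \<inter> J"
  shows "finprod (Hom_group C A B) p I \<in> Hom C A B \<inter> J"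
  using assms(5,6)
proof (induction I)
  case empty
  interpret G: comm_monoid "Hom_group C A B"
    using Hom_comm_monoid assms by blast
  show ?case
    unfolding G.finprod_empty using assms(1-3) Zero_closed by (simp add: Hom_group_def)
next
  case (insert i I)
  interpret G: comm_monoid "Hom_group C A B"
    using Hom_comm_monoid assms by blast
  have "p \<in> I \<rightarrow> carrier (Hom_group C A B)" "p i \<in> carrier (Hom_group C A B)"
    using insert.prems by (auto simp: Hom_group_def)
  then have "finprod (Hom_group C A B) p (insert i I) =
      p i \<boxplus> finprod (Hom_group C A B) p I"
    using insert.hyps by (simp add: G.finprod_insert) (simp add: Hom_group_def)
  then show ?case
    using insert add[of "p i"] Add_closed by auto
qed

text \<open>An ideal that contains the identities of the objects in \<open>M\<close> contains each
  \<open>\<iota> j\<close>, hence each \<open>\<pi> j \<odot> \<iota> j\<close>, hence their sum,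
  which is the identity of the direct sum. From there it reaches every morphism through an
  isomorphic object. The set \<open>J\<close> is kept abstract, so that the argument can be applied
  inside the diagram category.\<close>

lemma factoring_morphisms_generated_subset:
  assumes zero: "\<And>A B. A \<in> Obj C \<Longrightarrow> B \<in> Obj C \<Longrightarrow> Zero C A B \<in> J"
    and add: "\<And>A B f g. f \<in> Hom C A B \<inter> J \<Longrightarrow> g \<in> Hom C A B \<inter> J \<Longrightarrow> f \<boxplus> g \<in> J"
    and comp_left: "\<And>A B D f g. f \<in> Hom C A B \<Longrightarrow> g \<in> Hom C B D \<inter> J \<Longrightarrow> f \<odot> g \<in> J"
    and comp_right: "\<And>A B D f g. f \<in> Hom C A B \<inter> J \<Longrightarrow> g \<in> Hom C B D \<Longrightarrow> f \<odot> g \<in> J"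
    and ident: "\<And>X. X \<in> M \<Longrightarrow> Ident C X \<in> J"
  shows "factoring_morphisms C (generated_subcategory C M) \<subseteq> J"
proof
  fix f assume "f \<in> factoring_morphisms C (generated_subcategory C M)"
  then obtain K l X D g h where K: "K \<in> Obj C" and M: "\<And>j. j < l \<Longrightarrow> X j \<in> M"
    and D: "is_direct_sum C D l X" and iso: "isomorphic C K D"
    and g: "g \<in> Hom C (Dom C f) K" and h: "h \<in> Hom C K (Cod C f)" and f: "f = g \<odot> h"
    unfolding factoring_morphisms_def generated_subcategory_def full_subcategory_def
    by simp blast
  from D obtain \<iota> \<pi> where DO: "D \<in> Obj C" and XO: "\<And>j. j < l \<Longrightarrow> X j \<in> Obj C"
    and i: "\<And>j. j < l \<Longrightarrow> \<iota> j \<in> Hom C (X j) D" and p: "\<And>j. j < l \<Longrightarrow> \<pi> j \<in> Hom C D (X j)"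
    and sum: "finprod (Hom_group C D D) (\<lambda>j. \<pi> j \<odot> \<iota> j) {..<l} = Ident C D"
    unfolding is_direct_sum_def by metis
  have "\<pi> j \<odot> \<iota> j \<in> Hom C D D \<inter> J" if "j < l" for j
  proof -
    have "Ident C (X j) \<odot> \<iota> j \<in> J"
      using comp_right[OF _ i[OF that]] ident[OF M[OF that]] Ident_closed[OF XO[OF that]] by blast
    then have "\<iota> j \<in> J"
      using Ident_left[OF i[OF that]] by simp
    then show ?thesis
      using comp_left[OF p[OF that]] Comp_closed[OF p[OF that]] i[OF that] by blast
  qed
  then have idD: "Ident C D \<in> Hom C D D \<inter> J"
    unfolding sum[symmetric]
    by (intro finprod_Hom_in zero add DO) auto
  obtain u v where u: "u \<in> Hom C K D" and v: "v \<in> Hom C D K" and uv: "u \<odot> v = Ident C K"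
    using iso unfolding isomorphic_def by blast
  \<comment> \<open>Membership moves along the isomorphism: \<open>u = u \<odot> Ident C D\<close>
    lies in \<open>J\<close>, hence so does \<open>Ident C K = u \<odot> v\<close>.\<close>
  have "u \<in> J"
    using comp_left[OF u idD] Ident_right[OF u] by simp
  then have "Ident C K \<in> Hom C K K \<inter> J"
    using comp_right[of u K D v] u v uv Ident_closed[OF K] by auto
  then have "g \<in> J"
    using comp_left[OF g] Ident_right[OF g] by force
  then show "f \<in> J"
    using comp_right[OF _ h] g f by blast
qed

section \<open>Biproducts of two objects\<close>

definition biproduct :: "'a \<Rightarrow> 'a \<Rightarrow> 'a \<Rightarrow> 'b \<Rightarrow> 'b \<Rightarrow> 'b \<Rightarrow> 'b \<Rightarrow> bool" where
  "biproduct X Y D i\<^sub>0 i\<^sub>1 p\<^sub>0 p\<^sub>1 \<longleftrightarrow>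
    i\<^sub>0 \<in> Hom C X D \<and> i\<^sub>1 \<in> Hom C Y D \<and> p\<^sub>0 \<in> Hom C D X \<and> p\<^sub>1 \<in> Hom C D Y \<and>
    i\<^sub>0 \<odot> p\<^sub>0 = Ident C X \<and> i\<^sub>0 \<odot> p\<^sub>1 = Zero C X Y \<and>
    i\<^sub>1 \<odot> p\<^sub>0 = Zero C Y X \<and> i\<^sub>1 \<odot> p\<^sub>1 = Ident C Y \<and>
    p\<^sub>0 \<odot> i\<^sub>0 \<boxplus> p\<^sub>1 \<odot> i\<^sub>1 = Ident C D"

text \<open>Exposes the inclusions and projections by name, so that a biproduct of diagrams can be
  assembled from biproducts at its three positions. In the family, index 0 gives \<open>X\<close>
  and every other index gives \<open>Y\<close>; below 2 only the index 1 remains.\<close>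

lemma is_direct_sum_two_iff:
  "is_direct_sum C D 2 (\<lambda>j. if j = 0 then X else Y) \<longleftrightarrow>
    (\<exists>i\<^sub>0 i\<^sub>1 p\<^sub>0 p\<^sub>1. biproduct X Y D i\<^sub>0 i\<^sub>1 p\<^sub>0 p\<^sub>1)"
proof -
  have all2: "(\<forall>j<2::nat. P j) \<longleftrightarrow> P 0 \<and> P 1" for P
    by (auto simp: less_2_cases_iff)
  have sum: "finprod (Hom_group C D D) (\<lambda>j. \<pi> j \<odot> \<iota> j) {..<2::nat} = \<pi> 0 \<odot> \<iota> 0 \<boxplus> \<pi> 1 \<odot> \<iota> 1"
    if "\<iota> 0 \<in> Hom C X D" "\<pi> 0 \<in> Hom C D X" "\<iota> 1 \<in> Hom C Y D" "\<pi> 1 \<in> Hom C D Y" for \<iota> \<pi>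
    using that by (intro finprod_Hom_two) (blast intro: Comp_closed)+
  show ?thesis (is "?L \<longleftrightarrow> ?R")
  proof
    assume ?L
    then obtain \<iota> \<pi> where
      h: "\<iota> 0 \<in> Hom C X D" "\<pi> 0 \<in> Hom C D X" "\<iota> 1 \<in> Hom C Y D" "\<pi> 1 \<in> Hom C D Y"
      and "\<iota> 0 \<odot> \<pi> 0 = Ident C X" "\<iota> 0 \<odot> \<pi> 1 = Zero C X Y"
        "\<iota> 1 \<odot> \<pi> 0 = Zero C Y X" "\<iota> 1 \<odot> \<pi> 1 = Ident C Y"
        "finprod (Hom_group C D D) (\<lambda>j. \<pi> j \<odot> \<iota> j) {..<2::nat} = Ident C D"
      unfolding is_direct_sum_def all2 by auto
    then show ?R
      unfolding biproduct_def using sum[of \<iota> \<pi>, OF h]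
      by (intro exI[of _ "\<iota> 0"] exI[of _ "\<iota> 1"] exI[of _ "\<pi> 0"] exI[of _ "\<pi> 1"]) simp
  next
    assume ?R
    then obtain i\<^sub>0 i\<^sub>1 p\<^sub>0 p\<^sub>1 where *:
      "i\<^sub>0 \<in> Hom C X D" "i\<^sub>1 \<in> Hom C Y D" "p\<^sub>0 \<in> Hom C D X" "p\<^sub>1 \<in> Hom C D Y"
      "i\<^sub>0 \<odot> p\<^sub>0 = Ident C X" "i\<^sub>0 \<odot> p\<^sub>1 = Zero C X Y"
      "i\<^sub>1 \<odot> p\<^sub>0 = Zero C Y X" "i\<^sub>1 \<odot> p\<^sub>1 = Ident C Y"
      "p\<^sub>0 \<odot> i\<^sub>0 \<boxplus> p\<^sub>1 \<odot> i\<^sub>1 = Ident C D" unfolding biproduct_def by blast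
    have objs: "D \<in> Obj C" "X \<in> Obj C" "Y \<in> Obj C"
      using *(1,2) Hom_objects by auto
    let ?\<iota> = "\<lambda>j::nat. if j = 0 then i\<^sub>0 else i\<^sub>1" and ?\<pi> = "\<lambda>j::nat. if j = 0 then p\<^sub>0 else p\<^sub>1"
    show ?L
      unfolding is_direct_sum_def all2
      using * objs sum[of ?\<iota> ?\<pi>] by (intro conjI exI[of _ ?\<iota>] exI[of _ ?\<pi>]) simp_all
  qed
qed

text \<open>The witness is the diagonal map with entries \<open>x\<close> and \<open>y\<close>,
  written as the sum of its two entries, each preceded by a projection and followed by an inclusion.
  The four equations are the squares that later turn inclusions and projections into diagram
  morphisms.\<close>

lemma biproduct_map:
  assumes D: "biproduct X Y D i\<^sub>0 i\<^sub>1 p\<^sub>0 p\<^sub>1" and D': "biproduct X' Y' D' i\<^sub>0' i\<^sub>1' p\<^sub>0' p\<^sub>1'"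
    and x: "x \<in> Hom C X X'" and y: "y \<in> Hom C Y Y'"
  obtains d where "d \<in> Hom C D D'" "x \<odot> i\<^sub>0' = i\<^sub>0 \<odot> d" "y \<odot> i\<^sub>1' = i\<^sub>1 \<odot> d"
    "d \<odot> p\<^sub>0' = p\<^sub>0 \<odot> x" "d \<odot> p\<^sub>1' = p\<^sub>1 \<odot> y"
proof -
  note D = D[unfolded biproduct_def] and D' = D'[unfolded biproduct_def]
  have h: "i\<^sub>0 \<in> Hom C X D" "i\<^sub>1 \<in> Hom C Y D" "p\<^sub>0 \<in> Hom C D X" "p\<^sub>1 \<in> Hom C D Y"
    "i\<^sub>0' \<in> Hom C X' D'" "i\<^sub>1' \<in> Hom C Y' D'" "p\<^sub>0' \<in> Hom C D' X'" "p\<^sub>1' \<in> Hom C D' Y'"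
    using D D' by auto
  have O: "X \<in> Obj C" "Y \<in> Obj C" "D \<in> Obj C" "X' \<in> Obj C" "Y' \<in> Obj C" "D' \<in> Obj C"
    using h Hom_objects by blast+
  have xi: "x \<odot> i\<^sub>0' \<in> Hom C X D'" and yi: "y \<odot> i\<^sub>1' \<in> Hom C Y D'"
    using h x y Comp_closed by blast+
  have px: "p\<^sub>0 \<odot> (x \<odot> i\<^sub>0') \<in> Hom C D D'" and py: "p\<^sub>1 \<odot> (y \<odot> i\<^sub>1') \<in> Hom C D D'"
    using h xi yi Comp_closed by blast+
  let ?d = "p\<^sub>0 \<odot> (x \<odot> i\<^sub>0') \<boxplus> p\<^sub>1 \<odot> (y \<odot> i\<^sub>1')"
  have "i\<^sub>0 \<odot> ?d = i\<^sub>0 \<odot> p\<^sub>0 \<odot> (x \<odot> i\<^sub>0') \<boxplus> i\<^sub>0 \<odot> p\<^sub>1 \<odot> (y \<odot> i\<^sub>1')"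
    using Comp_Add_right[OF h(1) px py] Comp_assoc[OF h(1) h(3) xi] Comp_assoc[OF h(1) h(4) yi]
    by simp
  then have 1: "i\<^sub>0 \<odot> ?d = x \<odot> i\<^sub>0'"
    using D Ident_left[OF xi] Zero_Comp[OF O(1) yi] Add_Zero[OF xi] by simp
  have "i\<^sub>1 \<odot> ?d = i\<^sub>1 \<odot> p\<^sub>0 \<odot> (x \<odot> i\<^sub>0') \<boxplus> i\<^sub>1 \<odot> p\<^sub>1 \<odot> (y \<odot> i\<^sub>1')"
    using Comp_Add_right[OF h(2) px py] Comp_assoc[OF h(2) h(3) xi] Comp_assoc[OF h(2) h(4) yi]
    by simp
  then have 2: "i\<^sub>1 \<odot> ?d = y \<odot> i\<^sub>1'"
    using D Ident_left[OF yi] Zero_Comp[OF O(2) xi] Zero_Add[OF yi] by simp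
  have px': "p\<^sub>0 \<odot> x \<in> Hom C D X'" and py': "p\<^sub>1 \<odot> y \<in> Hom C D Y'"
    using h x y Comp_closed by blast+
  have assoc: "p\<^sub>0 \<odot> (x \<odot> i\<^sub>0') = (p\<^sub>0 \<odot> x) \<odot> i\<^sub>0'" "p\<^sub>1 \<odot> (y \<odot> i\<^sub>1') = (p\<^sub>1 \<odot> y) \<odot> i\<^sub>1'"
    using Comp_assoc[OF h(3) x h(5)] Comp_assoc[OF h(4) y h(6)] by simp_all
  have "?d \<odot> p\<^sub>0' = (p\<^sub>0 \<odot> x) \<odot> (i\<^sub>0' \<odot> p\<^sub>0') \<boxplus> (p\<^sub>1 \<odot> y) \<odot> (i\<^sub>1' \<odot> p\<^sub>0')"
    using Comp_Add_left[OF px py h(7)] Comp_assoc[OF px' h(5) h(7)] Comp_assoc[OF py' h(6) h(7)]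
    by (simp add: assoc)
  then have 3: "?d \<odot> p\<^sub>0' = p\<^sub>0 \<odot> x"
    using D' Ident_right[OF px'] Comp_Zero[OF py' O(4)] Add_Zero[OF px'] by simp
  have "?d \<odot> p\<^sub>1' = (p\<^sub>0 \<odot> x) \<odot> (i\<^sub>0' \<odot> p\<^sub>1') \<boxplus> (p\<^sub>1 \<odot> y) \<odot> (i\<^sub>1' \<odot> p\<^sub>1')"
    using Comp_Add_left[OF px py h(8)] Comp_assoc[OF px' h(5) h(8)] Comp_assoc[OF py' h(6) h(8)]
    by (simp add: assoc)
  then have 4: "?d \<odot> p\<^sub>1' = p\<^sub>1 \<odot> y"
    using D' Ident_right[OF py'] Comp_Zero[OF px' O(5)] Zero_Add[OF py'] by simp
  show ?thesis
    using that[OF Add_closed[OF px py] 1[symmetric] 2[symmetric] 3 4] .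
qed

text \<open>The sum is a matrix product: the row with entries \<open>g\<close> and \<open>g'\<close>
  followed by the column with entries \<open>h\<close> and \<open>h'\<close>, passing through the
  biproduct of \<open>P\<close> and \<open>Q\<close>.\<close>

lemma Add_factors_through_generated:
  assumes "P \<in> M" "Q \<in> M" and sum: "is_direct_sum C D 2 (\<lambda>j. if j = 0 then P else Q)"
    and g: "g \<in> Hom C A P" "g' \<in> Hom C A Q" and h: "h \<in> Hom C P B" "h' \<in> Hom C Q B"
  shows "g \<odot> h \<boxplus> g' \<odot> h' \<in> factoring_morphisms C (generated_subcategory C M)"
proof -
  obtain i\<^sub>0 i\<^sub>1 p\<^sub>0 p\<^sub>1 where D: "i\<^sub>0 \<in> Hom C P D" "i\<^sub>1 \<in> Hom C Q D"
      "p\<^sub>0 \<in> Hom C D P" "p\<^sub>1 \<in> Hom C D Q"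
    and ip: "i\<^sub>0 \<odot> p\<^sub>0 = Ident C P" "i\<^sub>0 \<odot> p\<^sub>1 = Zero C P Q"
      "i\<^sub>1 \<odot> p\<^sub>0 = Zero C Q P" "i\<^sub>1 \<odot> p\<^sub>1 = Ident C Q"
    using sum unfolding is_direct_sum_two_iff biproduct_def by blast
  have O: "P \<in> Obj C" "Q \<in> Obj C" "D \<in> Obj C"
    using D Hom_objects by blast+
  have ph: "p\<^sub>0 \<odot> h \<in> Hom C D B" "p\<^sub>1 \<odot> h' \<in> Hom C D B"
    using D h Comp_closed by blast+
  have gi: "g \<odot> i\<^sub>0 \<in> Hom C A D" "g' \<odot> i\<^sub>1 \<in> Hom C A D"
    using D g Comp_closed by blast+
  let ?G = "g \<odot> i\<^sub>0 \<boxplus> g' \<odot> i\<^sub>1" and ?H = "p\<^sub>0 \<odot> h \<boxplus> p\<^sub>1 \<odot> h'"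
  have G: "?G \<in> Hom C A D" and H: "?H \<in> Hom C D B"
    using ph gi Add_closed by blast+
  \<comment> \<open>Each inclusion followed by the column \<open>?H\<close> selects one entry, since
    the mixed composites of inclusions and projections vanish.\<close>
  have "i\<^sub>0 \<odot> ?H = i\<^sub>0 \<odot> p\<^sub>0 \<odot> h \<boxplus> i\<^sub>0 \<odot> p\<^sub>1 \<odot> h'"
    using Comp_Add_right[OF D(1) ph] Comp_assoc[OF D(1) D(3) h(1)] Comp_assoc[OF D(1) D(4) h(2)]
    by simp
  then have 1: "i\<^sub>0 \<odot> ?H = h"
    using ip Ident_left[OF h(1)] Zero_Comp[OF O(1) h(2)] Add_Zero[OF h(1)] by simp
  have "i\<^sub>1 \<odot> ?H = i\<^sub>1 \<odot> p\<^sub>0 \<odot> h \<boxplus> i\<^sub>1 \<odot> p\<^sub>1 \<odot> h'"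
    using Comp_Add_right[OF D(2) ph] Comp_assoc[OF D(2) D(3) h(1)] Comp_assoc[OF D(2) D(4) h(2)]
    by simp
  then have 2: "i\<^sub>1 \<odot> ?H = h'"
    using ip Ident_left[OF h(2)] Zero_Comp[OF O(2) h(1)] Zero_Add[OF h(2)] by simp
  have "?G \<odot> ?H = g \<odot> (i\<^sub>0 \<odot> ?H) \<boxplus> g' \<odot> (i\<^sub>1 \<odot> ?H)"
    using Comp_Add_left[OF gi H] Comp_assoc[OF g(1) D(1) H] Comp_assoc[OF g(2) D(2) H] by simp
  then have GH: "g \<odot> h \<boxplus> g' \<odot> h' = ?G \<odot> ?H"
    unfolding 1 2 by simp
  have "D \<in> Obj (generated_subcategory C M)"
    unfolding generated_subcategory_def full_subcategory_def
    using sum O isomorphic_refl assms(1,2)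
    by (auto intro!: exI[of _ 2] exI[of _ "\<lambda>j. if j = 0 then P else Q"])
  moreover have "?G \<odot> ?H \<in> Hom C A B"
    using G H Comp_closed by blast
  ultimately show ?thesis
    unfolding GH factoring_morphisms_def using G H by (auto simp: Hom_def)
qed

section \<open>The diagram category is preadditive\<close>

lemma Hom_diagram_iff:
  "f \<in> Hom (diagram_category C) A B \<longleftrightarrow> source f = A \<and> target f = B \<and>
    A \<in> Obj (diagram_category C) \<and> B \<in> Obj (diagram_category C) \<and>
    comp0 f \<in> Hom C (ob0 A) (ob0 B) \<and> comp1 f \<in> Hom C (ob1 A) (ob1 B) \<and>
    comp2 f \<in> Hom C (ob2 A) (ob2 B) \<and>
    map0 A \<odot> comp1 f = comp0 f \<odot> map0 B \<and> map1 A \<odot> comp2 f = comp1 f \<odot> map1 B"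
  by (cases f) (auto simp: Hom_def diagram_category_def)

text \<open>Domain and codomain of a morphism are objects, so the conditions on the two arrows
  already imply those on the three positions.\<close>

lemma Obj_diagram_iff:
  "A \<in> Obj (diagram_category C) \<longleftrightarrow>
    map0 A \<in> Hom C (ob0 A) (ob1 A) \<and> map1 A \<in> Hom C (ob1 A) (ob2 A)"
  using Hom_objects by (auto simp: diagram_category_def)

lemma diagram_simps:
  "Ident (diagram_category C) A =
    DMor A (Ident C (ob0 A)) (Ident C (ob1 A)) (Ident C (ob2 A)) A"
  "f \<odot>\<^bsub>diagram_category C\<^esub> g = DMor (source f) (comp0 f \<odot> comp0 g) (comp1 f \<odot> comp1 g)
    (comp2 f \<odot> comp2 g) (target g)"
  "f \<boxplus>\<^bsub>diagram_category C\<^esub> g = DMor (source f) (comp0 f \<boxplus> comp0 g) (comp1 f \<boxplus> comp1 g)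
    (comp2 f \<boxplus> comp2 g) (target f)"
  "Zero (diagram_category C) A B = DMor A (Zero C (ob0 A) (ob0 B)) (Zero C (ob1 A) (ob1 B))
    (Zero C (ob2 A) (ob2 B)) B"
  by (simp_all add: diagram_category_def)

lemma diagram_category_category: "category (diagram_category C)"
proof
  fix f assume "f \<in> Mor (diagram_category C)"
  then show "Dom (diagram_category C) f \<in> Obj (diagram_category C)"
    "Cod (diagram_category C) f \<in> Obj (diagram_category C)"
    by (auto simp: diagram_category_def)
next
  fix A assume "A \<in> Obj (diagram_category C)"
  then show "Ident (diagram_category C) A \<in> Hom (diagram_category C) A A"
    using Ident_closed Ident_left Ident_right Hom_objects
    by (simp add: Hom_diagram_iff diagram_simps Obj_diagram_iff) metis
next
  fix f g A B D
  assume f: "f \<in> Hom (diagram_category C) A B" and g: "g \<in> Hom (diagram_category C) B D"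
  have "map0 A \<odot> (comp1 f \<odot> comp1 g) = comp0 f \<odot> comp0 g \<odot> map0 D"
    by (rule Comp_squares) (use f g in \<open>auto simp: Hom_diagram_iff Obj_diagram_iff\<close>)
  moreover have "map1 A \<odot> (comp2 f \<odot> comp2 g) = comp1 f \<odot> comp1 g \<odot> map1 D"
    by (rule Comp_squares) (use f g in \<open>auto simp: Hom_diagram_iff Obj_diagram_iff\<close>)
  ultimately show "f \<odot>\<^bsub>diagram_category C\<^esub> g \<in> Hom (diagram_category C) A D"
    using f g by (auto simp: Hom_diagram_iff diagram_simps intro: Comp_closed)
next
  fix f A B assume "f \<in> Hom (diagram_category C) A B"
  then show "Ident (diagram_category C) A \<odot>\<^bsub>diagram_category C\<^esub> f = f"
    "f \<odot>\<^bsub>diagram_category C\<^esub> Ident (diagram_category C) B = f"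
    by (cases f; simp add: Hom_diagram_iff diagram_simps; metis Ident_left Ident_right)+
next
  fix f g h A B D E
  assume "f \<in> Hom (diagram_category C) A B" "g \<in> Hom (diagram_category C) B D"
    "h \<in> Hom (diagram_category C) D E"
  then show "f \<odot>\<^bsub>diagram_category C\<^esub> g \<odot>\<^bsub>diagram_category C\<^esub> h =
    f \<odot>\<^bsub>diagram_category C\<^esub> (g \<odot>\<^bsub>diagram_category C\<^esub> h)"
    by (simp add: Hom_diagram_iff diagram_simps) (metis Comp_assoc)
qed

lemma diagram_Add_closed:
  assumes f: "f \<in> Hom (diagram_category C) A B" and g: "g \<in> Hom (diagram_category C) A B"
  shows "f \<boxplus>\<^bsub>diagram_category C\<^esub> g \<in> Hom (diagram_category C) A B"
proof -
  have "map0 A \<odot> (comp1 f \<boxplus> comp1 g) = (comp0 f \<boxplus> comp0 g) \<odot> map0 B"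
    "map1 A \<odot> (comp2 f \<boxplus> comp2 g) = (comp1 f \<boxplus> comp1 g) \<odot> map1 B"
    by (rule Add_squares; use f g in \<open>auto simp: Hom_diagram_iff Obj_diagram_iff\<close>)+
  then show ?thesis
    using f g by (auto simp: Hom_diagram_iff diagram_simps intro: Add_closed)
qed

lemma diagram_Zero_closed:
  assumes "A \<in> Obj (diagram_category C)" "B \<in> Obj (diagram_category C)"
  shows "Zero (diagram_category C) A B \<in> Hom (diagram_category C) A B"
  using assms Zero_closed Zero_Comp Comp_Zero Hom_objects
  by (simp add: Hom_diagram_iff diagram_simps Obj_diagram_iff) metis

text \<open>Negatives are taken in each component as the difference of zero and that component. The
  point to verify is that the negated components again form commutative squares.\<close>

lemma diagram_negative_exists:
  assumes f: "f \<in> Hom (diagram_category C) A B"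
  obtains d where "d \<in> Hom (diagram_category C) A B"
    "d \<boxplus>\<^bsub>diagram_category C\<^esub> f = Zero (diagram_category C) A B"
proof -
  have A: "map0 A \<in> Hom C (ob0 A) (ob1 A)" "map1 A \<in> Hom C (ob1 A) (ob2 A)"
    and B: "map0 B \<in> Hom C (ob0 B) (ob1 B)" "map1 B \<in> Hom C (ob1 B) (ob2 B)"
    and fc: "comp0 f \<in> Hom C (ob0 A) (ob0 B)" "comp1 f \<in> Hom C (ob1 A) (ob1 B)"
      "comp2 f \<in> Hom C (ob2 A) (ob2 B)"
    and sq: "map0 A \<odot> comp1 f = comp0 f \<odot> map0 B" "map1 A \<odot> comp2 f = comp1 f \<odot> map1 B"
    using f by (auto simp: Hom_diagram_iff Obj_diagram_iff)
  obtain d0 where d0: "d0 \<in> Hom C (ob0 A) (ob0 B)" "d0 \<boxplus> comp0 f = Zero C (ob0 A) (ob0 B)"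
    using difference_exists[OF Zero_closed fc(1)] Hom_objects fc(1) by blast
  obtain d1 where d1: "d1 \<in> Hom C (ob1 A) (ob1 B)" "d1 \<boxplus> comp1 f = Zero C (ob1 A) (ob1 B)"
    using difference_exists[OF Zero_closed fc(2)] Hom_objects fc(2) by blast
  obtain d2 where d2: "d2 \<in> Hom C (ob2 A) (ob2 B)" "d2 \<boxplus> comp2 f = Zero C (ob2 A) (ob2 B)"
    using difference_exists[OF Zero_closed fc(3)] Hom_objects fc(3) by blast
  \<comment> \<open>Here \<open>e\<close> and \<open>d\<close> are the negatives of \<open>h\<close>
    and \<open>g\<close>. Both \<open>a \<odot> e\<close> and \<open>d \<odot> b\<close> give zero
    when added to \<open>a \<odot> h = g \<odot> b\<close>, so cancellation identifies them.\<close>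
  have sq_neg: "a \<odot> e = d \<odot> b"
    if "a \<in> Hom C X Y" "b \<in> Hom C X' Y'" "g \<in> Hom C X X'" "h \<in> Hom C Y Y'" "a \<odot> h = g \<odot> b"
      and "d \<in> Hom C X X'" "e \<in> Hom C Y Y'"
      and "d \<boxplus> g = Zero C X X'" "e \<boxplus> h = Zero C Y Y'" for a b g h d e X Y X' Y'
  proof -
    have "a \<odot> e \<boxplus> a \<odot> h = Zero C X Y'"
      using Comp_Add_right[of a X Y e Y' h] Comp_Zero[of a X Y Y'] Hom_objects that by metis
    moreover have "d \<odot> b \<boxplus> a \<odot> h = Zero C X Y'"
      using Comp_Add_left[of d X X' g b Y'] Zero_Comp[of X b X' Y'] Hom_objects that by metis
    ultimately show ?thesis
      using Add_right_cancel[of "a \<odot> e" X Y' "d \<odot> b" "a \<odot> h"] that(1,2,4,6,7)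
      by (metis Comp_closed)
  qed
  have "map0 A \<odot> d1 = d0 \<odot> map0 B"
    using sq_neg[OF A(1) B(1) fc(1,2) sq(1) d0(1) d1(1) d0(2) d1(2)] .
  moreover have "map1 A \<odot> d2 = d1 \<odot> map1 B"
    using sq_neg[OF A(2) B(2) fc(2,3) sq(2) d1(1) d2(1) d1(2) d2(2)] .
  ultimately have "DMor A d0 d1 d2 B \<in> Hom (diagram_category C) A B"
    using d0 d1 d2 f by (simp add: Hom_diagram_iff)
  moreover have "DMor A d0 d1 d2 B \<boxplus>\<^bsub>diagram_category C\<^esub> f = Zero (diagram_category C) A B"
    using d0 d1 d2 by (simp add: diagram_simps)
  ultimately show ?thesis using that by blast
qed

lemma diagram_category_preadditive: "preadditive_category (diagram_category C)"
proof (intro preadditive_category.intro preadditive_category_axioms.intro)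
  show "category (diagram_category C)" by (rule diagram_category_category)
next
  fix A B assume AB: "A \<in> Obj (diagram_category C)" "B \<in> Obj (diagram_category C)"
  show "comm_group (Hom_group (diagram_category C) A B)"
  proof (intro comm_groupI, simp_all add: Hom_group_def)
    show "Zero (diagram_category C) A B \<in> Hom (diagram_category C) A B"
      using AB by (rule diagram_Zero_closed)
  next
    fix f g assume "f \<in> Hom (diagram_category C) A B" "g \<in> Hom (diagram_category C) A B"
    then show "f \<boxplus>\<^bsub>diagram_category C\<^esub> g \<in> Hom (diagram_category C) A B"
      and "f \<boxplus>\<^bsub>diagram_category C\<^esub> g = g \<boxplus>\<^bsub>diagram_category C\<^esub> f"
      using diagram_Add_closed by (auto simp: Hom_diagram_iff diagram_simps intro: Add_commute)
  next
    fix f g h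
    assume "f \<in> Hom (diagram_category C) A B" "g \<in> Hom (diagram_category C) A B"
      "h \<in> Hom (diagram_category C) A B"
    then show "f \<boxplus>\<^bsub>diagram_category C\<^esub> g \<boxplus>\<^bsub>diagram_category C\<^esub> h =
        f \<boxplus>\<^bsub>diagram_category C\<^esub> (g \<boxplus>\<^bsub>diagram_category C\<^esub> h)"
      by (auto simp: Hom_diagram_iff diagram_simps intro: Add_assoc)
  next
    fix f assume f: "f \<in> Hom (diagram_category C) A B"
    then show "Zero (diagram_category C) A B \<boxplus>\<^bsub>diagram_category C\<^esub> f = f"
      by (cases f) (auto simp: Hom_diagram_iff diagram_simps Zero_Add)
    show "\<exists>d\<in>Hom (diagram_category C) A B.
        d \<boxplus>\<^bsub>diagram_category C\<^esub> f = Zero (diagram_category C) A B"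
      using diagram_negative_exists[OF f] by blast
  qed
next
  fix f f' g A B D
  assume "f \<in> Hom (diagram_category C) A B" "f' \<in> Hom (diagram_category C) A B"
    "g \<in> Hom (diagram_category C) B D"
  then show "(f \<boxplus>\<^bsub>diagram_category C\<^esub> f') \<odot>\<^bsub>diagram_category C\<^esub> g =
    f \<odot>\<^bsub>diagram_category C\<^esub> g \<boxplus>\<^bsub>diagram_category C\<^esub> f' \<odot>\<^bsub>diagram_category C\<^esub> g"
    by (auto simp: Hom_diagram_iff diagram_simps intro: Comp_Add_left)
next
  fix f g g' A B D
  assume "f \<in> Hom (diagram_category C) A B" "g \<in> Hom (diagram_category C) B D"
    "g' \<in> Hom (diagram_category C) B D"
  then show "f \<odot>\<^bsub>diagram_category C\<^esub> (g \<boxplus>\<^bsub>diagram_category C\<^esub> g') =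
    f \<odot>\<^bsub>diagram_category C\<^esub> g \<boxplus>\<^bsub>diagram_category C\<^esub> f \<odot>\<^bsub>diagram_category C\<^esub> g'"
    by (auto simp: Hom_diagram_iff diagram_simps intro: Comp_Add_right)
qed

section \<open>Null-homotopic morphisms form an ideal\<close>

lemma null_homotopic_iff:
  assumes "f \<in> Hom (diagram_category C) A B"
  shows "f \<in> null_homotopic C \<longleftrightarrow>
    (\<exists>s \<in> Hom C (ob1 A) (ob0 B). \<exists>t \<in> Hom C (ob2 A) (ob1 B).
      s \<odot> map0 B \<boxplus> map1 A \<odot> t = comp1 f)"
proof -
  have "f \<in> Mor (diagram_category C)" "source f = A" "target f = B"
    using assms Hom_diagram_iff by (auto simp: Hom_def[of "diagram_category C"])
  then show ?thesis by (simp add: null_homotopic_def)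
qed

lemma null_homotopicI:
  assumes "f \<in> Hom (diagram_category C) A B"
    and "s \<in> Hom C (ob1 A) (ob0 B)" "t \<in> Hom C (ob2 A) (ob1 B)"
    and "s \<odot> map0 B \<boxplus> map1 A \<odot> t = comp1 f"
  shows "f \<in> null_homotopic C"
  using assms null_homotopic_iff by blast

lemma null_homotopic_Zero:
  assumes "A \<in> Obj (diagram_category C)" "B \<in> Obj (diagram_category C)"
  shows "Zero (diagram_category C) A B \<in> null_homotopic C"
proof -
  have A: "map1 A \<in> Hom C (ob1 A) (ob2 A)" and B: "map0 B \<in> Hom C (ob0 B) (ob1 B)"
    using assms by (auto simp: Obj_diagram_iff)
  have "Zero C (ob1 A) (ob0 B) \<odot> map0 B \<boxplus> map1 A \<odot> Zero C (ob2 A) (ob1 B) =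
      Zero C (ob1 A) (ob1 B)"
    using A B by (metis Zero_Comp Comp_Zero Zero_Add Zero_closed Hom_objects)
  then show ?thesis
    using Hom_objects[OF A] Hom_objects[OF B]
    by (intro null_homotopicI[OF diagram_Zero_closed[OF assms]])
      (simp_all add: diagram_simps Zero_closed)
qed

text \<open>Homotopies add: \<open>s \<boxplus> s'\<close> and \<open>t \<boxplus> t'\<close> form a
  homotopy for the sum.\<close>

lemma null_homotopic_Add:
  assumes "f \<in> Hom (diagram_category C) A B \<inter> null_homotopic C"
    and "g \<in> Hom (diagram_category C) A B \<inter> null_homotopic C"
  shows "f \<boxplus>\<^bsub>diagram_category C\<^esub> g \<in> null_homotopic C"
proof -
  have f: "f \<in> Hom (diagram_category C) A B" and g: "g \<in> Hom (diagram_category C) A B"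
    using assms by auto
  have A: "map1 A \<in> Hom C (ob1 A) (ob2 A)" and B: "map0 B \<in> Hom C (ob0 B) (ob1 B)"
    using f by (auto simp: Hom_diagram_iff Obj_diagram_iff)
  obtain s t where st: "s \<in> Hom C (ob1 A) (ob0 B)" "t \<in> Hom C (ob2 A) (ob1 B)"
    "s \<odot> map0 B \<boxplus> map1 A \<odot> t = comp1 f"
    using assms null_homotopic_iff[OF f] by blast
  obtain s' t' where st': "s' \<in> Hom C (ob1 A) (ob0 B)" "t' \<in> Hom C (ob2 A) (ob1 B)"
    "s' \<odot> map0 B \<boxplus> map1 A \<odot> t' = comp1 g"
    using assms null_homotopic_iff[OF g] by blast
  have "(s \<boxplus> s') \<odot> map0 B \<boxplus> map1 A \<odot> (t \<boxplus> t') =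
      (s \<odot> map0 B \<boxplus> s' \<odot> map0 B) \<boxplus> (map1 A \<odot> t \<boxplus> map1 A \<odot> t')"
    using Comp_Add_left[OF st(1) st'(1) B] Comp_Add_right[OF A st(2) st'(2)] by simp
  also have "\<dots> = comp1 f \<boxplus> comp1 g"
    unfolding st(3)[symmetric] st'(3)[symmetric]
    using st st' A B by (intro Add_interchange) (blast intro: Comp_closed)+
  finally show ?thesis
    using st st'
    by (intro null_homotopicI[OF diagram_Add_closed[OF f g]])
      (simp_all add: diagram_simps Add_closed)
qed

text \<open>A homotopy \<open>s\<close>, \<open>t\<close> for \<open>g\<close> yields
  \<open>comp1 f \<odot> s\<close> and \<open>comp2 f \<odot> t\<close> for the composite; the
  second square of \<open>f\<close> moves \<open>map1 B\<close> across
  \<open>comp1 f\<close>.\<close>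

lemma null_homotopic_Comp_left:
  assumes f: "f \<in> Hom (diagram_category C) A B"
    and g: "g \<in> Hom (diagram_category C) B D \<inter> null_homotopic C"
  shows "f \<odot>\<^bsub>diagram_category C\<^esub> g \<in> null_homotopic C"
proof -
  have fg: "f \<odot>\<^bsub>diagram_category C\<^esub> g \<in> Hom (diagram_category C) A D"
    using category.Comp_closed[OF diagram_category_category] f g by blast
  have A: "map1 A \<in> Hom C (ob1 A) (ob2 A)" and B: "map1 B \<in> Hom C (ob1 B) (ob2 B)"
    and D: "map0 D \<in> Hom C (ob0 D) (ob1 D)"
    and fc: "comp1 f \<in> Hom C (ob1 A) (ob1 B)" "comp2 f \<in> Hom C (ob2 A) (ob2 B)"
    and sq: "map1 A \<odot> comp2 f = comp1 f \<odot> map1 B"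
    using f g by (auto simp: Hom_diagram_iff Obj_diagram_iff)
  obtain s t where st: "s \<in> Hom C (ob1 B) (ob0 D)" "t \<in> Hom C (ob2 B) (ob1 D)"
    "s \<odot> map0 D \<boxplus> map1 B \<odot> t = comp1 g"
    using g null_homotopic_iff by blast
  have "comp1 f \<odot> comp1 g = comp1 f \<odot> (s \<odot> map0 D) \<boxplus> comp1 f \<odot> (map1 B \<odot> t)"
    unfolding st(3)[symmetric]
    using st D B by (intro Comp_Add_right[OF fc(1)]) (blast intro: Comp_closed)+
  also have "comp1 f \<odot> (s \<odot> map0 D) = (comp1 f \<odot> s) \<odot> map0 D"
    using Comp_assoc[OF fc(1) st(1) D] by simp
  also have "comp1 f \<odot> (map1 B \<odot> t) = map1 A \<odot> (comp2 f \<odot> t)"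
    using Comp_assoc[OF fc(1) B st(2)] Comp_assoc[OF A fc(2) st(2)] sq by simp
  finally have "comp1 f \<odot> s \<odot> map0 D \<boxplus> map1 A \<odot> (comp2 f \<odot> t) = comp1 f \<odot> comp1 g" ..
  then show ?thesis
    using Comp_closed[OF fc(1) st(1)] Comp_closed[OF fc(2) st(2)]
    by (intro null_homotopicI[OF fg]) (simp_all add: diagram_simps)
qed

text \<open>Dually, a homotopy \<open>s\<close>, \<open>t\<close> for \<open>f\<close> yields
  \<open>s \<odot> comp0 g\<close> and \<open>t \<odot> comp1 g\<close>, by the first square of
  \<open>g\<close>.\<close>

lemma null_homotopic_Comp_right:
  assumes f: "f \<in> Hom (diagram_category C) A B \<inter> null_homotopic C"
    and g: "g \<in> Hom (diagram_category C) B D"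
  shows "f \<odot>\<^bsub>diagram_category C\<^esub> g \<in> null_homotopic C"
proof -
  have fg: "f \<odot>\<^bsub>diagram_category C\<^esub> g \<in> Hom (diagram_category C) A D"
    using category.Comp_closed[OF diagram_category_category] f g by blast
  have A: "map1 A \<in> Hom C (ob1 A) (ob2 A)" and B: "map0 B \<in> Hom C (ob0 B) (ob1 B)"
    and D: "map0 D \<in> Hom C (ob0 D) (ob1 D)"
    and gc: "comp0 g \<in> Hom C (ob0 B) (ob0 D)" "comp1 g \<in> Hom C (ob1 B) (ob1 D)"
    and sq: "map0 B \<odot> comp1 g = comp0 g \<odot> map0 D"
    using f g by (auto simp: Hom_diagram_iff Obj_diagram_iff)
  obtain s t where st: "s \<in> Hom C (ob1 A) (ob0 B)" "t \<in> Hom C (ob2 A) (ob1 B)"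
    "s \<odot> map0 B \<boxplus> map1 A \<odot> t = comp1 f"
    using f null_homotopic_iff by blast
  have "comp1 f \<odot> comp1 g = s \<odot> map0 B \<odot> comp1 g \<boxplus> map1 A \<odot> t \<odot> comp1 g"
    unfolding st(3)[symmetric]
    using st A B by (intro Comp_Add_left[OF _ _ gc(2)]) (blast intro: Comp_closed)+
  also have "s \<odot> map0 B \<odot> comp1 g = s \<odot> comp0 g \<odot> map0 D"
    using Comp_assoc[OF st(1) B gc(2)] Comp_assoc[OF st(1) gc(1) D] sq by simp
  also have "map1 A \<odot> t \<odot> comp1 g = map1 A \<odot> (t \<odot> comp1 g)"
    using Comp_assoc[OF A st(2) gc(2)] by simp
  finally have "s \<odot> comp0 g \<odot> map0 D \<boxplus> map1 A \<odot> (t \<odot> comp1 g) = comp1 f \<odot> comp1 g" ..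
  then show ?thesis
    using Comp_closed[OF st(1) gc(1)] Comp_closed[OF st(2) gc(2)]
    by (intro null_homotopicI[OF fg]) (simp_all add: diagram_simps)
qed

section \<open>Morphisms factoring through the generated subcategory are null-homotopic\<close>

lemma S_objects_Obj: "S_objects C \<subseteq> Obj (diagram_category C)"
  unfolding S_objects_def Obj_diagram_iff subset_iff
  using Ident_closed Hom_objects by fastforce

text \<open>The identity arrow of the diagram, read backwards, is the homotopy: if the first arrow
  is an identity, take \<open>s\<close> to be that identity and \<open>t\<close> zero; if the second
  is, take \<open>s\<close> zero and \<open>t\<close> to be that identity.\<close>

lemma null_homotopic_Ident_S_objects:
  assumes "X \<in> S_objects C"
  shows "Ident (diagram_category C) X \<in> null_homotopic C"
proof -
  have "Ident (diagram_category C) X \<in> Hom (diagram_category C) X X"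
    using category.Ident_closed[OF diagram_category_category] S_objects_Obj assms by blast
  note nh = null_homotopicI[OF this]
  from assms consider
    U V s where "X = Diag U (Ident C U) U s V" "s \<in> Hom C U V" |
    U V s where "X = Diag U s V (Ident C V) V" "s \<in> Hom C U V"
    by (auto simp: S_objects_def)
  then show ?thesis
  proof cases
    case 1
    then have UV: "U \<in> Obj C" "V \<in> Obj C" using Hom_objects by auto
    have "Ident C U \<odot> Ident C U \<boxplus> s \<odot> Zero C V U = Ident C U"
      using Ident_closed[OF UV(1)] Ident_left Comp_Zero[OF 1(2) UV(1)] Add_Zero by metis
    then show ?thesis
      using nh[of "Ident C U" "Zero C V U"] 1 UV Ident_closed Zero_closed
      by (simp add: diagram_simps)
  next
    case 2
    then have UV: "U \<in> Obj C" "V \<in> Obj C" using Hom_objects by auto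
    have "Zero C V U \<odot> s \<boxplus> Ident C V \<odot> Ident C V = Ident C V"
      using Ident_closed[OF UV(2)] Ident_left Zero_Comp[OF UV(2) 2(2)] Zero_Add by metis
    then show ?thesis
      using nh[of "Zero C V U" "Ident C V"] 2 UV Ident_closed Zero_closed
      by (simp add: diagram_simps)
  qed
qed

lemma factoring_morphisms_S_subset_null_homotopic:
  "factoring_morphisms (diagram_category C)
    (generated_subcategory (diagram_category C) (S_objects C)) \<subseteq> null_homotopic C"
  by (rule preadditive_category.factoring_morphisms_generated_subset[OF diagram_category_preadditive])
    (fact null_homotopic_Zero null_homotopic_Add null_homotopic_Comp_left
      null_homotopic_Comp_right null_homotopic_Ident_S_objects)+

end

section \<open>Biproducts of diagrams and the converse inclusion\<close>

context additive_category
begin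

lemma biproduct_exists:
  assumes "X \<in> Obj C" "Y \<in> Obj C"
  obtains D i\<^sub>0 i\<^sub>1 p\<^sub>0 p\<^sub>1 where "biproduct X Y D i\<^sub>0 i\<^sub>1 p\<^sub>0 p\<^sub>1"
proof -
  obtain D where "is_direct_sum C D 2 (\<lambda>j. if j = 0 then X else Y)"
    using direct_sum_exists[of 2 "\<lambda>j. if j = 0 then X else Y"] assms by (metis (full_types))
  then show ?thesis
    unfolding is_direct_sum_two_iff using that by blast
qed

text \<open>Biproducts are chosen at each of the three positions and joined by the diagonal maps of
  \<open>biproduct_map\<close>, whose equations are the squares required of inclusions and
  projections.\<close>

lemma diagram_direct_sum_exists:
  assumes "X \<in> Obj (diagram_category C)" "Y \<in> Obj (diagram_category C)"
  obtains D where "is_direct_sum (diagram_category C) D 2 (\<lambda>j. if j = 0 then X else Y)"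
proof -
  interpret diag: preadditive_category "diagram_category C"
    by (rule diagram_category_preadditive)
  have x: "map0 X \<in> Hom C (ob0 X) (ob1 X)" "map1 X \<in> Hom C (ob1 X) (ob2 X)"
    and y: "map0 Y \<in> Hom C (ob0 Y) (ob1 Y)" "map1 Y \<in> Hom C (ob1 Y) (ob2 Y)"
    using assms by (auto simp: Obj_diagram_iff)
  obtain D\<^sub>0 i\<^sub>0 j\<^sub>0 p\<^sub>0 q\<^sub>0 where D0: "biproduct (ob0 X) (ob0 Y) D\<^sub>0 i\<^sub>0 j\<^sub>0 p\<^sub>0 q\<^sub>0"
    using biproduct_exists Hom_objects(1)[OF x(1)] Hom_objects(1)[OF y(1)] by metis
  obtain D\<^sub>1 i\<^sub>1 j\<^sub>1 p\<^sub>1 q\<^sub>1 where D1: "biproduct (ob1 X) (ob1 Y) D\<^sub>1 i\<^sub>1 j\<^sub>1 p\<^sub>1 q\<^sub>1"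
    using biproduct_exists Hom_objects(2)[OF x(1)] Hom_objects(2)[OF y(1)] by metis
  obtain D\<^sub>2 i\<^sub>2 j\<^sub>2 p\<^sub>2 q\<^sub>2 where D2: "biproduct (ob2 X) (ob2 Y) D\<^sub>2 i\<^sub>2 j\<^sub>2 p\<^sub>2 q\<^sub>2"
    using biproduct_exists Hom_objects(2)[OF x(2)] Hom_objects(2)[OF y(2)] by metis
  obtain d\<^sub>0 where d0: "d\<^sub>0 \<in> Hom C D\<^sub>0 D\<^sub>1" "map0 X \<odot> i\<^sub>1 = i\<^sub>0 \<odot> d\<^sub>0" "map0 Y \<odot> j\<^sub>1 = j\<^sub>0 \<odot> d\<^sub>0"
      "d\<^sub>0 \<odot> p\<^sub>1 = p\<^sub>0 \<odot> map0 X" "d\<^sub>0 \<odot> q\<^sub>1 = q\<^sub>0 \<odot> map0 Y"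
    using biproduct_map[OF D0 D1 x(1) y(1)] .
  obtain d\<^sub>1 where d1: "d\<^sub>1 \<in> Hom C D\<^sub>1 D\<^sub>2" "map1 X \<odot> i\<^sub>2 = i\<^sub>1 \<odot> d\<^sub>1" "map1 Y \<odot> j\<^sub>2 = j\<^sub>1 \<odot> d\<^sub>1"
      "d\<^sub>1 \<odot> p\<^sub>2 = p\<^sub>1 \<odot> map1 X" "d\<^sub>1 \<odot> q\<^sub>2 = q\<^sub>1 \<odot> map1 Y"
    using biproduct_map[OF D1 D2 x(2) y(2)] .
  let ?D = "Diag D\<^sub>0 d\<^sub>0 D\<^sub>1 d\<^sub>1 D\<^sub>2"
  have D: "?D \<in> Obj (diagram_category C)"
    using d0 d1 by (simp add: Obj_diagram_iff)
  have "diag.biproduct X Y ?D (DMor X i\<^sub>0 i\<^sub>1 i\<^sub>2 ?D) (DMor Y j\<^sub>0 j\<^sub>1 j\<^sub>2 ?D)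
      (DMor ?D p\<^sub>0 p\<^sub>1 p\<^sub>2 X) (DMor ?D q\<^sub>0 q\<^sub>1 q\<^sub>2 Y)"
    unfolding diag.biproduct_def
    using assms D d0 d1 D0[unfolded biproduct_def] D1[unfolded biproduct_def]
      D2[unfolded biproduct_def]
    by (simp add: Hom_diagram_iff diagram_simps)
  then show ?thesis
    using that diag.is_direct_sum_two_iff by blast
qed

lemma null_homotopic_subset_factoring_morphisms_S:
  "null_homotopic C \<subseteq> factoring_morphisms (diagram_category C)
    (generated_subcategory (diagram_category C) (S_objects C))"
proof
  fix f assume nf: "f \<in> null_homotopic C"
  interpret diag: preadditive_category "diagram_category C"
    by (rule diagram_category_preadditive)
  obtain A B where f: "f \<in> Hom (diagram_category C) A B"
    using nf by (auto simp: null_homotopic_def Hom_def)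
  obtain s t where s: "s \<in> Hom C (ob1 A) (ob0 B)" and t: "t \<in> Hom C (ob2 A) (ob1 B)"
    and st: "s \<odot> map0 B \<boxplus> map1 A \<odot> t = comp1 f"
    using nf null_homotopic_iff[OF f] by blast
  have A: "map0 A \<in> Hom C (ob0 A) (ob1 A)" "map1 A \<in> Hom C (ob1 A) (ob2 A)"
    and B: "map0 B \<in> Hom C (ob0 B) (ob1 B)" "map1 B \<in> Hom C (ob1 B) (ob2 B)"
    and AB: "A \<in> Obj (diagram_category C)" "B \<in> Obj (diagram_category C)"
    and fc: "comp0 f \<in> Hom C (ob0 A) (ob0 B)" "comp1 f \<in> Hom C (ob1 A) (ob1 B)"
      "comp2 f \<in> Hom C (ob2 A) (ob2 B)"
    and sq: "map0 A \<odot> comp1 f = comp0 f \<odot> map0 B" "map1 A \<odot> comp2 f = comp1 f \<odot> map1 B"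
    using f by (auto simp: Hom_diagram_iff Obj_diagram_iff)
  have sb: "s \<odot> map0 B \<in> Hom C (ob1 A) (ob1 B)" and at: "map1 A \<odot> t \<in> Hom C (ob1 A) (ob1 B)"
    and as: "map0 A \<odot> s \<in> Hom C (ob0 A) (ob0 B)" and tb: "t \<odot> map1 B \<in> Hom C (ob2 A) (ob2 B)"
    using s t A B Comp_closed by blast+
  \<comment> \<open>\<open>k\<close> and \<open>h\<close> are what remains of the outer components
    of \<open>f\<close>: \<open>comp0 f\<close> minus \<open>map0 A \<odot> s\<close>, and
    \<open>comp2 f\<close> minus \<open>t \<odot> map1 B\<close>.\<close>
  obtain k where k: "k \<in> Hom C (ob0 A) (ob0 B)" "k \<boxplus> map0 A \<odot> s = comp0 f"
    using difference_exists[OF fc(1) as] .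
  obtain h where h: "h \<in> Hom C (ob2 A) (ob2 B)" "h \<boxplus> t \<odot> map1 B = comp2 f"
    using difference_exists[OF fc(3) tb] .
  \<comment> \<open>The first square of \<open>?g'\<close>: expand \<open>comp1 f\<close> and
    \<open>comp0 f\<close> in the first square of \<open>f\<close> and cancel
    \<open>map0 A \<odot> (s \<odot> map0 B)\<close>.\<close>
  have ksq: "map0 A \<odot> (map1 A \<odot> t) = k \<odot> map0 B"
  proof -
    have kb: "k \<odot> map0 B \<in> Hom C (ob0 A) (ob1 B)"
      and aat: "map0 A \<odot> (map1 A \<odot> t) \<in> Hom C (ob0 A) (ob1 B)"
      and asb: "map0 A \<odot> (s \<odot> map0 B) \<in> Hom C (ob0 A) (ob1 B)"
      using k A B at sb Comp_closed by blast+
    have "map0 A \<odot> (map1 A \<odot> t) \<boxplus> map0 A \<odot> (s \<odot> map0 B) = map0 A \<odot> comp1 f"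
      unfolding st[symmetric] Comp_Add_right[OF A(1) sb at] by (rule Add_commute[OF aat asb])
    also have "\<dots> = k \<odot> map0 B \<boxplus> map0 A \<odot> (s \<odot> map0 B)"
      unfolding sq k(2)[symmetric] Comp_Add_left[OF k(1) as B(1)] Comp_assoc[OF A(1) s B(1)] ..
    finally show ?thesis
      unfolding Add_right_cancel[OF aat kb asb] .
  qed
  \<comment> \<open>The second square of \<open>?h\<close>: expand \<open>comp2 f\<close> and
    \<open>comp1 f\<close> in the second square of \<open>f\<close> and cancel
    \<open>map1 A \<odot> (t \<odot> map1 B)\<close>.\<close>
  have hsq: "map1 A \<odot> h = s \<odot> map0 B \<odot> map1 B"
  proof -
    have ah: "map1 A \<odot> h \<in> Hom C (ob1 A) (ob2 B)"
      and sbb: "s \<odot> map0 B \<odot> map1 B \<in> Hom C (ob1 A) (ob2 B)"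
      and atb: "map1 A \<odot> (t \<odot> map1 B) \<in> Hom C (ob1 A) (ob2 B)"
      using h A B sb tb Comp_closed by blast+
    have "map1 A \<odot> h \<boxplus> map1 A \<odot> (t \<odot> map1 B) = comp1 f \<odot> map1 B"
      unfolding sq[symmetric] h(2)[symmetric] Comp_Add_right[OF A(2) h(1) tb] ..
    also have "\<dots> = s \<odot> map0 B \<odot> map1 B \<boxplus> map1 A \<odot> (t \<odot> map1 B)"
      unfolding st[symmetric] Comp_Add_left[OF sb at B(2)] Comp_assoc[OF A(2) t B(2)] ..
    finally show ?thesis
      unfolding Add_right_cancel[OF ah sbb atb] .
  qed
  let ?P = "Diag (ob1 A) (Ident C (ob1 A)) (ob1 A) (map1 A) (ob2 A)"
  let ?Q = "Diag (ob0 B) (map0 B) (ob1 B) (Ident C (ob1 B)) (ob1 B)"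
  have PQ: "?P \<in> S_objects C" "?Q \<in> S_objects C"
    using A B by (auto simp: S_objects_def)
  then have PQ': "?P \<in> Obj (diagram_category C)" "?Q \<in> Obj (diagram_category C)"
    using S_objects_Obj by auto
  obtain D where D: "is_direct_sum (diagram_category C) D 2 (\<lambda>j. if j = 0 then ?P else ?Q)"
    using diagram_direct_sum_exists[OF PQ'] .
  have id: "Ident C (ob1 A) \<in> Hom C (ob1 A) (ob1 A)" "Ident C (ob2 A) \<in> Hom C (ob2 A) (ob2 A)"
    "Ident C (ob0 B) \<in> Hom C (ob0 B) (ob0 B)" "Ident C (ob1 B) \<in> Hom C (ob1 B) (ob1 B)"
    using A B Ident_closed Hom_objects by blast+
  note ids = Ident_left[OF A(2)] Ident_left[OF s] Ident_left[OF sb] Ident_left[OF h(1)]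
    Ident_left[OF B(1)] Ident_left[OF B(2)] Ident_right[OF A(1)] Ident_right[OF A(2)]
    Ident_right[OF k(1)] Ident_right[OF at] Ident_right[OF B(1)]
  let ?g = "DMor A (map0 A) (Ident C (ob1 A)) (Ident C (ob2 A)) ?P"
  let ?h = "DMor ?P s (s \<odot> map0 B) h B"
  let ?g' = "DMor A k (map1 A \<odot> t) t ?Q"
  let ?h' = "DMor ?Q (Ident C (ob0 B)) (Ident C (ob1 B)) (map1 B) B"
  \<comment> \<open>Of the eight squares, six hold by the identity laws; the other two are
    \<open>ksq\<close> and \<open>hsq\<close>.\<close>
  have "?g \<in> Hom (diagram_category C) A ?P" "?h \<in> Hom (diagram_category C) ?P B"
    "?g' \<in> Hom (diagram_category C) A ?Q" "?h' \<in> Hom (diagram_category C) ?Q B"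
    using AB PQ' A B s t sb at h(1) k(1) id
    by (simp_all add: Hom_diagram_iff ids hsq ksq)
  \<comment> \<open>The first component on the right is
    \<open>map0 A \<odot> s \<boxplus> k\<close>, in the opposite order to the equation defining
    \<open>k\<close>; hence \<open>Add_commute\<close>.\<close>
  moreover have "f = ?g \<odot>\<^bsub>diagram_category C\<^esub> ?h \<boxplus>\<^bsub>diagram_category C\<^esub> ?g' \<odot>\<^bsub>diagram_category C\<^esub> ?h'"
    using f Add_commute[OF k(1) as] k(2) h(2) st
    by (cases f) (simp add: Hom_diagram_iff diagram_simps ids)
  ultimately show "f \<in> factoring_morphisms (diagram_category C)
      (generated_subcategory (diagram_category C) (S_objects C))"
    using diag.Add_factors_through_generated[OF PQ D] by metis
qed

end

theorem mainTheorem3: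
  fixes \<A> :: "('o, 'm) precategory"
  assumes "additive_category \<A>"
  shows "factoring_morphisms (diagram_category \<A>)
           (generated_subcategory (diagram_category \<A>) (S_objects \<A>)) = null_homotopic \<A> \<and>
         Adel \<A> = quotient_by_subcategory (diagram_category \<A>)
           (generated_subcategory (diagram_category \<A>) (S_objects \<A>))"
proof -
  interpret additive_category \<A> by fact
  have "factoring_morphisms (diagram_category \<A>)
      (generated_subcategory (diagram_category \<A>) (S_objects \<A>)) = null_homotopic \<A>"
    using factoring_morphisms_S_subset_null_homotopic null_homotopic_subset_factoring_morphisms_S
    by blast
  \<comment> \<open>Both quotients are \<open>quotient_category\<close> of the diagram category,
    taken at sets of morphisms that are now equal, so they coincide literally.\<close>
  then show ?thesis
    by (simp add: Adel_def quotient_by_subcategory_def)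
qed

end
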